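(* On an almost Norden manifold $(M,J,g)\notin\mathcal W_2\oplus\mathcal W_3$ there exists a four-parametric family of completely symmetric connections $\nabla$, defined by $\nabla_XY=\nabla^0_XY+Q(X,Y)$ with difference tensor $$\begin{aligned}Q(X,Y)={}&\lambda_1\theta(X)\theta(Y)\Omega+\lambda_2\theta(JX)\theta(JY)J\Omega\\&+\lambda_3[\theta(X)\theta(Y)J\Omega+\theta(X)\theta(JY)\Omega+\theta(JX)\theta(Y)\Omega]\\&+\lambda_4[\theta(JX)\theta(Y)J\Omega+\theta(JX)\theta(JY)\Omega+\theta(X)\theta(JY)J\Omega],\end{aligned}$$ $\lambda_i\in\mathbb R$ $(i=1,2,3,4)$; that is, for all $\lambda_1,\dots,\lambda_4\in\mathbb R$ this $\nabla$ is a completely symmetric connection.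
   Context: An almost Norden manifold $(M,J,g)$ is a differentiable $2n$-dimensional manifold $M$ with an almost complex structure $J$ ($J^2=-\mathrm{id}$) and a pseudo-Riemannian metric $g$ such that $g(JX,JY)=-g(X,Y)$. Let $\nabla^0$ be the Levi-Civita connection of $g$ and $F(X,Y,Z)=g((\nabla^0_XJ)Y,Z)$. The Lie 1-form $\theta$ and the vector field $\Omega$ are defined by $\theta(X)=g^{ij}F(e_i,e_j,X)=g(X,\Omega)$, where $\{e_i\}$ is any local basis and $(g^{ij})$ is the inverse matrix of $(g(e_i,e_j))$. The class $\mathcal W_2\oplus\mathcal W_3$ (of the Ganchev–Borisov classification) consists of the almost Norden manifolds with $\theta=0$. A connection $\nabla=\nabla^0+Q$ is completely symmetric if it is torsion free and $Q(X,Y,Z)=g(Q(X,Y),Z)$ is completely symmetric, i.e. $Q(X,Y,Z)=Q(Y,X,Z)=Q(X,Z,Y)$ (equivalently, $\nabla$ is torsion free and $(\nabla_Xg)(Y,Z)=(\nabla_Yg)(X,Z)$). *)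

theory Defs
  imports "HOL-Analysis.Analysis" "HOL-Library.Function_Algebras"
begin

primrec k_smooth_on ::
  "'b::euclidean_space set \<Rightarrow> nat \<Rightarrow> ('b \<Rightarrow> 'c::real_normed_vector) \<Rightarrow> bool" where
  "k_smooth_on S 0 f \<longleftrightarrow> continuous_on S f"
| "k_smooth_on S (Suc k) f \<longleftrightarrow>
     (\<forall>x\<in>S. f differentiable (at x)) \<and>
     (\<forall>v. k_smooth_on S k (\<lambda>x. frechet_derivative f (at x) v))"

text \<open>Only used for open \<open>S\<close>.\<close>
definition smooth_on :: "'b::euclidean_space set \<Rightarrow> ('b \<Rightarrow> 'c::real_normed_vector) \<Rightarrow> bool" where
  "smooth_on S f \<longleftrightarrow> (\<forall>k. k_smooth_on S k f)"

text \<open>The manifold is the whole type \<open>'a\<close>, with its Hausdorff and second countable topology; a chart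
  is a pair (domain, coordinate map) with values in \<open>real ^ 'm\<close>. The atlas need not be maximal.\<close>
type_synonym ('a, 'm) chart = "'a set \<times> ('a \<Rightarrow> real ^ 'm)"

definition is_chart ::
  "('a::{t2_space,second_countable_topology}, 'm::finite) chart \<Rightarrow> bool" where
  "is_chart c \<longleftrightarrow> (case c of (U, \<phi>) \<Rightarrow>
     open U \<and> open (\<phi> ` U) \<and> homeomorphism U (\<phi> ` U) \<phi> (inv_into U \<phi>))"

definition smooth_atlas ::
  "('a::{t2_space,second_countable_topology}, 'm::finite) chart set \<Rightarrow> bool" where
  "smooth_atlas A \<longleftrightarrow>
     (\<forall>c\<in>A. is_chart c) \<and> (\<Union>(U, \<phi>)\<in>A. U) = UNIV \<and>
     (\<forall>(U, \<phi>)\<in>A. \<forall>(V, \<psi>)\<in>A. smooth_on (\<phi> ` (U \<inter> V)) (\<psi> \<circ> inv_into U \<phi>))"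

definition smooth_funs ::
  "('a::{t2_space,second_countable_topology}, 'm::finite) chart set \<Rightarrow> ('a \<Rightarrow> real) set" where
  "smooth_funs A = {f. \<forall>(U, \<phi>)\<in>A. smooth_on (\<phi> ` U) (f \<circ> inv_into U \<phi>)}"

text \<open>Tangent vectors at \<open>p\<close> are derivations at \<open>p\<close> of the algebra of smooth functions. They are
  total functionals on \<open>'a \<Rightarrow> real\<close>; the value \<open>0\<close> on non-smooth arguments makes the
  representation unique. Sums and negatives of tangent vectors and of vector fields, and sums and
  products of real functions, are the pointwise ones of \<^theory>\<open>HOL-Library.Function_Algebras\<close>.\<close>
type_synonym 'a tvec = "('a \<Rightarrow> real) \<Rightarrow> real"

type_synonym 'a vfield = "'a \<Rightarrow> 'a tvec"

definition tscale :: "real \<Rightarrow> 'a tvec \<Rightarrow> 'a tvec" where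
  "tscale c v = (\<lambda>f. c * v f)"

definition tangent_space ::
  "('a::{t2_space,second_countable_topology}, 'm::finite) chart set \<Rightarrow> 'a \<Rightarrow> 'a tvec set" where
  "tangent_space A p = {v.
     (\<forall>f. f \<notin> smooth_funs A \<longrightarrow> v f = 0) \<and>
     (\<forall>f\<in>smooth_funs A. \<forall>h\<in>smooth_funs A. v (f + h) = v f + v h) \<and>
     (\<forall>c. \<forall>f\<in>smooth_funs A. v (\<lambda>q. c * f q) = c * v f) \<and>
     (\<forall>f\<in>smooth_funs A. \<forall>h\<in>smooth_funs A. v (f * h) = f p * v h + h p * v f)}"

definition fscale :: "('a \<Rightarrow> real) \<Rightarrow> 'a vfield \<Rightarrow> 'a vfield"  (infixr \<open>\<odot>\<close> 75) where
  "h \<odot> X = (\<lambda>p. tscale (h p) (X p))"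

definition vderiv :: "'a vfield \<Rightarrow> ('a \<Rightarrow> real) \<Rightarrow> ('a \<Rightarrow> real)" where
  "vderiv X f = (\<lambda>p. X p f)"

definition vector_fields ::
  "('a::{t2_space,second_countable_topology}, 'm::finite) chart set \<Rightarrow> 'a vfield set" where
  "vector_fields A = {X. (\<forall>p. X p \<in> tangent_space A p) \<and>
     (\<forall>f\<in>smooth_funs A. vderiv X f \<in> smooth_funs A)}"

definition lie_bracket :: "'a vfield \<Rightarrow> 'a vfield \<Rightarrow> 'a vfield" where
  "lie_bracket X Y = (\<lambda>p f. X p (vderiv Y f) - Y p (vderiv X f))"

definition tangent_basis ::
  "('a::{t2_space,second_countable_topology}, 'm::finite) chart set \<Rightarrow> 'a \<Rightarrow> ('m \<Rightarrow> 'a tvec) \<Rightarrow> bool" where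
  "tangent_basis A p b \<longleftrightarrow>
     (\<forall>i. b i \<in> tangent_space A p) \<and>
     (\<forall>v\<in>tangent_space A p. \<exists>!c. v = (\<Sum>i\<in>UNIV. tscale (c i) (b i)))"

text \<open>Connections act on global vector fields, so a local basis on \<open>U\<close> is taken to consist of global
  vector fields that form a basis of the tangent space at every point of \<open>U\<close>. Every local frame
  agrees with one of these near any given point of its domain (multiply by a bump function).\<close>
definition local_basis ::
  "('a::{t2_space,second_countable_topology}, 'm::finite) chart set \<Rightarrow> 'a set \<Rightarrow> ('m \<Rightarrow> 'a vfield) \<Rightarrow> bool" where
  "local_basis A U e \<longleftrightarrow> open U \<and> (\<forall>i. e i \<in> vector_fields A) \<and>
     (\<forall>p\<in>U. tangent_basis A p (\<lambda>i. e i p))"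

definition endo_app :: "('a \<Rightarrow> 'a tvec \<Rightarrow> 'a tvec) \<Rightarrow> 'a vfield \<Rightarrow> 'a vfield" where
  "endo_app J X = (\<lambda>p. J p (X p))"

definition form_app ::
  "('a \<Rightarrow> 'a tvec \<Rightarrow> 'a tvec \<Rightarrow> real) \<Rightarrow> 'a vfield \<Rightarrow> 'a vfield \<Rightarrow> ('a \<Rightarrow> real)" where
  "form_app g X Y = (\<lambda>p. g p (X p) (Y p))"

definition almost_complex ::
  "('a::{t2_space,second_countable_topology}, 'm::finite) chart set \<Rightarrow> ('a \<Rightarrow> 'a tvec \<Rightarrow> 'a tvec) \<Rightarrow> bool" where
  "almost_complex A J \<longleftrightarrow>
     (\<forall>p. \<forall>v\<in>tangent_space A p.
        J p v \<in> tangent_space A p \<and> J p (J p v) = - v \<and>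
        (\<forall>c. J p (tscale c v) = tscale c (J p v)) \<and>
        (\<forall>w\<in>tangent_space A p. J p (v + w) = J p v + J p w)) \<and>
     (\<forall>X\<in>vector_fields A. endo_app J X \<in> vector_fields A)"

definition pseudo_riemannian ::
  "('a::{t2_space,second_countable_topology}, 'm::finite) chart set
     \<Rightarrow> ('a \<Rightarrow> 'a tvec \<Rightarrow> 'a tvec \<Rightarrow> real) \<Rightarrow> bool" where
  "pseudo_riemannian A g \<longleftrightarrow>
     (\<forall>p. \<forall>u\<in>tangent_space A p. \<forall>v\<in>tangent_space A p.
        g p u v = g p v u \<and>
        (\<forall>c. g p (tscale c u) v = c * g p u v) \<and>
        (\<forall>w\<in>tangent_space A p. g p (u + w) v = g p u v + g p w v)) \<and>
     (\<forall>p. \<forall>u\<in>tangent_space A p. (\<forall>v\<in>tangent_space A p. g p u v = 0) \<longrightarrow> u = 0) \<and>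
     (\<forall>X\<in>vector_fields A. \<forall>Y\<in>vector_fields A. form_app g X Y \<in> smooth_funs A)"

definition almost_norden ::
  "('a::{t2_space,second_countable_topology}, 'm::finite) chart set \<Rightarrow> ('a \<Rightarrow> 'a tvec \<Rightarrow> 'a tvec)
     \<Rightarrow> ('a \<Rightarrow> 'a tvec \<Rightarrow> 'a tvec \<Rightarrow> real) \<Rightarrow> bool" where
  "almost_norden A J g \<longleftrightarrow> smooth_atlas A \<and> almost_complex A J \<and> pseudo_riemannian A g \<and>
     (\<forall>p. \<forall>u\<in>tangent_space A p. \<forall>v\<in>tangent_space A p. g p (J p u) (J p v) = - g p u v)"

definition connection ::
  "('a::{t2_space,second_countable_topology}, 'm::finite) chart set
     \<Rightarrow> ('a vfield \<Rightarrow> 'a vfield \<Rightarrow> 'a vfield) \<Rightarrow> bool" where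
  "connection A D \<longleftrightarrow>
     (\<forall>X\<in>vector_fields A. \<forall>Y\<in>vector_fields A.
        D X Y \<in> vector_fields A \<and>
        (\<forall>f\<in>smooth_funs A. D (f \<odot> X) Y = f \<odot> D X Y) \<and>
        (\<forall>f\<in>smooth_funs A. D X (f \<odot> Y) = vderiv X f \<odot> Y + f \<odot> D X Y) \<and>
        (\<forall>Z\<in>vector_fields A. D (X + Z) Y = D X Y + D Z Y \<and> D X (Y + Z) = D X Y + D X Z))"

definition torsion_free ::
  "('a::{t2_space,second_countable_topology}, 'm::finite) chart set
     \<Rightarrow> ('a vfield \<Rightarrow> 'a vfield \<Rightarrow> 'a vfield) \<Rightarrow> bool" where
  "torsion_free A D \<longleftrightarrow>
     (\<forall>X\<in>vector_fields A. \<forall>Y\<in>vector_fields A. D X Y - D Y X - lie_bracket X Y = 0)"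

definition metric_connection ::
  "('a::{t2_space,second_countable_topology}, 'm::finite) chart set
     \<Rightarrow> ('a \<Rightarrow> 'a tvec \<Rightarrow> 'a tvec \<Rightarrow> real) \<Rightarrow> ('a vfield \<Rightarrow> 'a vfield \<Rightarrow> 'a vfield) \<Rightarrow> bool" where
  "metric_connection A g D \<longleftrightarrow>
     (\<forall>X\<in>vector_fields A. \<forall>Y\<in>vector_fields A. \<forall>Z\<in>vector_fields A.
        vderiv X (form_app g Y Z) = form_app g (D X Y) Z + form_app g Y (D X Z))"

definition levi_civita ::
  "('a::{t2_space,second_countable_topology}, 'm::finite) chart set
     \<Rightarrow> ('a \<Rightarrow> 'a tvec \<Rightarrow> 'a tvec \<Rightarrow> real) \<Rightarrow> ('a vfield \<Rightarrow> 'a vfield \<Rightarrow> 'a vfield) \<Rightarrow> bool" where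
  "levi_civita A g D \<longleftrightarrow> connection A D \<and> torsion_free A D \<and> metric_connection A g D"

definition completely_symmetric ::
  "('a::{t2_space,second_countable_topology}, 'm::finite) chart set
     \<Rightarrow> ('a \<Rightarrow> 'a tvec \<Rightarrow> 'a tvec \<Rightarrow> real) \<Rightarrow> ('a vfield \<Rightarrow> 'a vfield \<Rightarrow> 'a vfield)
     \<Rightarrow> ('a vfield \<Rightarrow> 'a vfield \<Rightarrow> 'a vfield) \<Rightarrow> bool" where
  "completely_symmetric A g D0 D \<longleftrightarrow> torsion_free A D \<and>
     (let Q = (\<lambda>X Y Z. form_app g (D X Y - D0 X Y) Z) in
      \<forall>X\<in>vector_fields A. \<forall>Y\<in>vector_fields A. \<forall>Z\<in>vector_fields A.
        Q X Y Z = Q Y X Z \<and> Q X Y Z = Q X Z Y)"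

text \<open>\<open>F(X, Y, Z) = g ((D\<^sub>X J) Y, Z)\<close> with \<open>(D\<^sub>X J) Y = D\<^sub>X (J Y) - J (D\<^sub>X Y)\<close>.\<close>
definition fundamental_tensor ::
  "('a \<Rightarrow> 'a tvec \<Rightarrow> 'a tvec) \<Rightarrow> ('a \<Rightarrow> 'a tvec \<Rightarrow> 'a tvec \<Rightarrow> real)
     \<Rightarrow> ('a vfield \<Rightarrow> 'a vfield \<Rightarrow> 'a vfield)
     \<Rightarrow> 'a vfield \<Rightarrow> 'a vfield \<Rightarrow> 'a vfield \<Rightarrow> ('a \<Rightarrow> real)" where
  "fundamental_tensor J g D X Y Z = form_app g (D X (endo_app J Y) - endo_app J (D X Y)) Z"

text \<open>The description is by the common value for all local bases around the point.\<close>
definition lie_form ::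
  "('a::{t2_space,second_countable_topology}, 'm::finite) chart set
     \<Rightarrow> ('a \<Rightarrow> 'a tvec \<Rightarrow> 'a tvec) \<Rightarrow> ('a \<Rightarrow> 'a tvec \<Rightarrow> 'a tvec \<Rightarrow> real)
     \<Rightarrow> ('a vfield \<Rightarrow> 'a vfield \<Rightarrow> 'a vfield) \<Rightarrow> 'a vfield \<Rightarrow> ('a \<Rightarrow> real)" where
  "lie_form A J g D X p = (THE c. \<forall>U e. local_basis A U e \<and> p \<in> U \<longrightarrow>
     c = (\<Sum>i\<in>UNIV. \<Sum>j\<in>UNIV.
            matrix_inv (\<chi> k l. g p (e k p) (e l p)) $ i $ j
              * fundamental_tensor J g D (e i) (e j) X p))"

definition is_lie_vector ::
  "('a::{t2_space,second_countable_topology}, 'm::finite) chart set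
     \<Rightarrow> ('a \<Rightarrow> 'a tvec \<Rightarrow> 'a tvec) \<Rightarrow> ('a \<Rightarrow> 'a tvec \<Rightarrow> 'a tvec \<Rightarrow> real)
     \<Rightarrow> ('a vfield \<Rightarrow> 'a vfield \<Rightarrow> 'a vfield) \<Rightarrow> 'a vfield \<Rightarrow> bool" where
  "is_lie_vector A J g D \<Omega> \<longleftrightarrow> \<Omega> \<in> vector_fields A \<and>
     (\<forall>X\<in>vector_fields A. lie_form A J g D X = form_app g X \<Omega>)"

definition class_W2_W3 ::
  "('a::{t2_space,second_countable_topology}, 'm::finite) chart set
     \<Rightarrow> ('a \<Rightarrow> 'a tvec \<Rightarrow> 'a tvec) \<Rightarrow> ('a \<Rightarrow> 'a tvec \<Rightarrow> 'a tvec \<Rightarrow> real) \<Rightarrow> bool" where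
  "class_W2_W3 A J g \<longleftrightarrow> almost_norden A J g \<and>
     (\<forall>D. levi_civita A g D \<longrightarrow> (\<forall>X\<in>vector_fields A. lie_form A J g D X = 0))"

definition difference_tensor ::
  "('a vfield \<Rightarrow> ('a \<Rightarrow> real)) \<Rightarrow> ('a vfield \<Rightarrow> 'a vfield) \<Rightarrow> 'a vfield
     \<Rightarrow> real \<Rightarrow> real \<Rightarrow> real \<Rightarrow> real \<Rightarrow> 'a vfield \<Rightarrow> 'a vfield \<Rightarrow> 'a vfield" where
  "difference_tensor \<theta> J \<Omega> l1 l2 l3 l4 X Y =
     (\<lambda>_. l1) \<odot> (\<theta> X * \<theta> Y) \<odot> \<Omega>
     + (\<lambda>_. l2) \<odot> (\<theta> (J X) * \<theta> (J Y)) \<odot> J \<Omega>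
     + (\<lambda>_. l3) \<odot> ((\<theta> X * \<theta> Y) \<odot> J \<Omega> + (\<theta> X * \<theta> (J Y)) \<odot> \<Omega> + (\<theta> (J X) * \<theta> Y) \<odot> \<Omega>)
     + (\<lambda>_. l4) \<odot> ((\<theta> (J X) * \<theta> Y) \<odot> J \<Omega> + (\<theta> (J X) * \<theta> (J Y)) \<odot> \<Omega> + (\<theta> X * \<theta> (J Y)) \<odot> J \<Omega>)"

end

theory Submission
  imports Defs
begin

text \<open>As \<open>\<theta> X = g X \<Omega>\<close> is \<open>C\<^sup>\<infinity>\<close>-linear and \<open>J\<close> is self-adjoint for a Norden metric, lowering the index
  turns \<open>\<Omega>\<close> and \<open>J \<Omega>\<close> into \<open>\<theta>\<close> and \<open>\<theta> \<circ> J\<close>. The four summands of \<open>Q\<close> thereby become the four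
  monomials of degree three in the commuting 1-forms \<open>\<theta>\<close> and \<open>\<theta> \<circ> J\<close>, which are completely
  symmetric, and adding a symmetric tensor to a torsion free connection keeps it torsion free.\<close>

section \<open>Calculus of \<open>k_smooth_on\<close> on open sets\<close>

lemma frechet_derivative_cong_open:
  assumes "open S" "x \<in> S" "\<And>y. y \<in> S \<Longrightarrow> f y = g y"
  shows "frechet_derivative f (at x) = frechet_derivative g (at x)"
proof -
  \<comment> \<open>\<open>frechet_derivative\<close> is a choice among all derivatives at the
    point. Functions agreeing near \<open>x\<close> have the same candidates, so the chosen maps
    coincide, even where no derivative exists.\<close>
  have "(f has_derivative D) (at x) \<longleftrightarrow> (g has_derivative D) (at x)" for D
    using assms has_derivative_transform_within_open[of f D x UNIV S g]
      has_derivative_transform_within_open[of g D x UNIV S f] by auto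
  then show ?thesis by (simp add: frechet_derivative_def)
qed

text \<open>The sum and product rules determine \<open>frechet_derivative\<close> only at points of
  \<open>S\<close>, whereas the recursion in \<open>k_smooth_on\<close> takes derivatives of total
  functions. Openness of \<open>S\<close> makes behaviour off \<open>S\<close> invisible to all
  these derivatives, so the rules can be substituted there.\<close>

lemma k_smooth_on_cong:
  assumes "open S" "\<And>x. x \<in> S \<Longrightarrow> f x = g x"
  shows "k_smooth_on S k f \<longleftrightarrow> k_smooth_on S k g"
  using assms(2)
proof (induction k arbitrary: f g)
  case 0
  then show ?case by (simp cong: continuous_on_cong)
next
  case (Suc k)
  have "f differentiable (at x) \<longleftrightarrow> g differentiable (at x)" if "x \<in> S" for x
    using that assms(1) Suc.prems has_derivative_transform_within_open[of f _ x UNIV S g]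
      has_derivative_transform_within_open[of g _ x UNIV S f]
    by (auto simp: differentiable_def)
  moreover have "k_smooth_on S k (\<lambda>x. frechet_derivative f (at x) v)
      \<longleftrightarrow> k_smooth_on S k (\<lambda>x. frechet_derivative g (at x) v)" for v
    using frechet_derivative_cong_open[OF assms(1) _ Suc.prems] by (intro Suc.IH) simp
  ultimately show ?case by simp
qed

text \<open>Order 0 is the implication from differentiable to continuous; at higher orders the
  induction hypothesis applies to each directional derivative.\<close>

lemma k_smooth_on_SucD: "k_smooth_on S (Suc k) f \<Longrightarrow> k_smooth_on S k f"
proof (induction k arbitrary: f)
  case 0
  then show ?case
    by (auto intro!: continuous_at_imp_continuous_on differentiable_imp_continuous_within)
qed auto

lemma k_smooth_on_const: "k_smooth_on S k (\<lambda>_. c)"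
  by (induction k arbitrary: c) auto

lemma k_smooth_on_add:
  assumes "open S" "k_smooth_on S k f" "k_smooth_on S k g"
  shows "k_smooth_on S k (\<lambda>x. f x + g x)"
  using assms(2,3)
proof (induction k arbitrary: f g)
  case 0
  then show ?case by (auto intro: continuous_on_add)
next
  case (Suc k)
  have d: "frechet_derivative (\<lambda>x. f x + g x) (at x)
      = (\<lambda>v. frechet_derivative f (at x) v + frechet_derivative g (at x) v)" if "x \<in> S" for x
    using Suc.prems that
    by (intro frechet_derivative_at[symmetric] has_derivative_add)
      (auto simp: frechet_derivative_works)
  have "k_smooth_on S k (\<lambda>x. frechet_derivative (\<lambda>x. f x + g x) (at x) v)" for v
    using Suc.IH[of "\<lambda>x. frechet_derivative f (at x) v" "\<lambda>x. frechet_derivative g (at x) v"]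
      Suc.prems
    by (subst k_smooth_on_cong[OF assms(1)]) (auto simp: d)
  then show ?case using Suc.prems by (auto intro: differentiable_add)
qed

lemma k_smooth_on_mult:
  fixes f g :: "'b::euclidean_space \<Rightarrow> 'c::real_normed_algebra"
  assumes "open S" "k_smooth_on S k f" "k_smooth_on S k g"
  shows "k_smooth_on S k (\<lambda>x. f x * g x)"
  using assms(2,3)
proof (induction k arbitrary: f g)
  case 0
  then show ?case by (auto intro: continuous_on_mult)
next
  case (Suc k)
  have d: "frechet_derivative (\<lambda>x. f x * g x) (at x)
      = (\<lambda>v. f x * frechet_derivative g (at x) v + frechet_derivative f (at x) v * g x)"
    if "x \<in> S" for x
    using Suc.prems that
    by (intro frechet_derivative_at[symmetric] has_derivative_mult)
      (auto simp: frechet_derivative_works)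
  \<comment> \<open>The product rule leaves one factor undifferentiated. That factor is given at
    order \<open>Suc k\<close> and must be lowered to order \<open>k\<close> before the induction
    hypothesis covers both products.\<close>
  have "k_smooth_on S k (\<lambda>x. f x * frechet_derivative g (at x) v
      + frechet_derivative f (at x) v * g x)" for v
    using Suc.prems k_smooth_on_SucD[OF Suc.prems(1)] k_smooth_on_SucD[OF Suc.prems(2)]
    by (intro k_smooth_on_add[OF assms(1)] Suc.IH) auto
  then have "k_smooth_on S k (\<lambda>x. frechet_derivative (\<lambda>x. f x * g x) (at x) v)" for v
    by (subst k_smooth_on_cong[OF assms(1)]) (auto simp: d)
  then show ?case using Suc.prems by (auto intro: differentiable_mult)
qed

section \<open>Closure properties of tangent vectors, smooth functions and vector fields\<close>

lemma tangent_space_add: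
  "u \<in> tangent_space A p \<Longrightarrow> v \<in> tangent_space A p \<Longrightarrow> u + v \<in> tangent_space A p"
  by (auto simp: tangent_space_def algebra_simps)

lemma tangent_space_tscale: "v \<in> tangent_space A p \<Longrightarrow> tscale c v \<in> tangent_space A p"
  by (auto simp: tangent_space_def tscale_def algebra_simps)

lemma smooth_funs_const: "(\<lambda>_. c) \<in> smooth_funs A"
  by (auto simp: smooth_funs_def smooth_on_def o_def k_smooth_on_const)

context
  fixes A :: "('a::{t2_space,second_countable_topology}, 'm::finite) chart set"
  assumes A: "smooth_atlas A"
begin

text \<open>Supplies the openness assumption of the sum and product rules in each chart.\<close>

lemma open_chart_image: "(U, \<phi>) \<in> A \<Longrightarrow> open (\<phi> ` U)"
  using A by (auto simp: smooth_atlas_def is_chart_def)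

lemma smooth_funs_add: "f \<in> smooth_funs A \<Longrightarrow> h \<in> smooth_funs A \<Longrightarrow> f + h \<in> smooth_funs A"
  by (fastforce simp: smooth_funs_def smooth_on_def o_def intro: k_smooth_on_add open_chart_image)

lemma smooth_funs_mult: "f \<in> smooth_funs A \<Longrightarrow> h \<in> smooth_funs A \<Longrightarrow> f * h \<in> smooth_funs A"
  by (fastforce simp: smooth_funs_def smooth_on_def o_def intro: k_smooth_on_mult open_chart_image)

lemma vector_fields_add:
  assumes "X \<in> vector_fields A" "Y \<in> vector_fields A"
  shows "X + Y \<in> vector_fields A"
proof -
  have "vderiv (X + Y) f = vderiv X f + vderiv Y f" for f
    by (auto simp: vderiv_def)
  then show ?thesis
    using assms by (auto simp: vector_fields_def intro: tangent_space_add smooth_funs_add)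
qed

lemma vector_fields_fscale:
  assumes "h \<in> smooth_funs A" "X \<in> vector_fields A"
  shows "h \<odot> X \<in> vector_fields A"
proof -
  have "vderiv (h \<odot> X) f = h * vderiv X f" for f
    by (auto simp: vderiv_def fscale_def tscale_def)
  then show ?thesis
    using assms
    by (auto simp: vector_fields_def fscale_def intro: tangent_space_tscale smooth_funs_mult)
qed

end

section \<open>Pointwise algebra of vector fields, \<open>J\<close>, \<open>g\<close> and the
  difference tensor\<close>

lemma fscale_algebra:
  fixes X Y :: "'a vfield"
  shows "(f + h) \<odot> X = f \<odot> X + h \<odot> X"
    and "f \<odot> (X + Y) = f \<odot> X + f \<odot> Y"
    and "f \<odot> h \<odot> X = (f * h) \<odot> X"
  by (auto simp: fscale_def tscale_def fun_eq_iff algebra_simps)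

lemma endo_app_add:
  assumes "almost_complex A J" "X \<in> vector_fields A" "Y \<in> vector_fields A"
  shows "endo_app J (X + Y) = endo_app J X + endo_app J Y"
  using assms by (auto simp: almost_complex_def endo_app_def vector_fields_def fun_eq_iff)

lemma endo_app_fscale:
  assumes "almost_complex A J" "X \<in> vector_fields A"
  shows "endo_app J (f \<odot> X) = f \<odot> endo_app J X"
  using assms by (auto simp: almost_complex_def endo_app_def fscale_def vector_fields_def fun_eq_iff)

lemma endo_app_vector_fields:
  "almost_complex A J \<Longrightarrow> X \<in> vector_fields A \<Longrightarrow> endo_app J X \<in> vector_fields A"
  by (simp add: almost_complex_def)

lemma form_app_commute:
  assumes "pseudo_riemannian A g" "X \<in> vector_fields A" "Y \<in> vector_fields A"
  shows "form_app g X Y = form_app g Y X"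
  using assms by (auto simp: pseudo_riemannian_def form_app_def vector_fields_def fun_eq_iff)

lemma form_app_add:
  assumes "pseudo_riemannian A g" "X \<in> vector_fields A" "Y \<in> vector_fields A" "Z \<in> vector_fields A"
  shows "form_app g (X + Y) Z = form_app g X Z + form_app g Y Z"
  using assms by (auto simp: pseudo_riemannian_def form_app_def vector_fields_def fun_eq_iff)

lemma form_app_fscale:
  assumes "pseudo_riemannian A g" "X \<in> vector_fields A" "Z \<in> vector_fields A"
  shows "form_app g (f \<odot> X) Z = f * form_app g X Z"
  using assms
  by (auto simp: pseudo_riemannian_def form_app_def fscale_def vector_fields_def fun_eq_iff)

lemma form_app_smooth:
  "pseudo_riemannian A g \<Longrightarrow> X \<in> vector_fields A \<Longrightarrow> Y \<in> vector_fields A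
    \<Longrightarrow> form_app g X Y \<in> smooth_funs A"
  by (simp add: pseudo_riemannian_def)

text \<open>Evaluate \<open>g p (J p u) (J p (J p v))\<close> in two ways: the Norden condition
  gives \<open>- g p u (J p v)\<close>, and \<open>J p (J p v) = - v\<close> gives
  \<open>- g p (J p u) v\<close>.\<close>

lemma norden_self_adjoint:
  assumes "almost_norden A J g" "u \<in> tangent_space A p" "v \<in> tangent_space A p"
  shows "g p (J p u) v = g p u (J p v)"
proof -
  have Jv: "J p v \<in> tangent_space A p" "J p (J p v) = - v"
    and Ju: "J p u \<in> tangent_space A p"
    using assms by (auto simp: almost_norden_def almost_complex_def)
  \<comment> \<open>The metric axioms give homogeneity for \<open>tscale\<close> in the first
    argument; with the negative in this form, symmetry carries it to the second.\<close>
  have minus: "- v = tscale (-1) v"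
    by (auto simp: tscale_def)
  have "tscale (-1) v \<in> tangent_space A p"
    using assms(3) by (rule tangent_space_tscale)
  then have "g p (J p u) (- v) = - g p (J p u) v"
    using assms Ju unfolding minus almost_norden_def pseudo_riemannian_def
    by (metis mult_minus1)
  moreover have "g p (J p u) (J p (J p v)) = - g p u (J p v)"
    using assms Jv(1) by (auto simp: almost_norden_def)
  ultimately show ?thesis using Jv(2) by simp
qed

text \<open>Collecting the summands along \<Omega> and \<open>J \<Omega>\<close> leaves two scalar
  coefficients symmetric in \<open>X\<close> and \<open>Y\<close>, so smoothness, symmetry and
  linearity of the tensor can be read off from them.\<close>

lemma difference_tensor_eq:
  "difference_tensor \<theta> J \<Omega> l1 l2 l3 l4 X Y =
     ((\<lambda>_. l1) * \<theta> X * \<theta> Y + (\<lambda>_. l3) * (\<theta> X * \<theta> (J Y) + \<theta> (J X) * \<theta> Y)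
       + (\<lambda>_. l4) * \<theta> (J X) * \<theta> (J Y)) \<odot> \<Omega>
     + ((\<lambda>_. l2) * \<theta> (J X) * \<theta> (J Y) + (\<lambda>_. l3) * \<theta> X * \<theta> Y
       + (\<lambda>_. l4) * (\<theta> (J X) * \<theta> Y + \<theta> X * \<theta> (J Y))) \<odot> J \<Omega>"
  by (auto simp: difference_tensor_def fscale_def tscale_def fun_eq_iff algebra_simps)

section \<open>Connection axioms and complete symmetry of the family\<close>

theorem proposition4p5:
  fixes A :: "('a::{t2_space,second_countable_topology}, 'm::finite) chart set"
    and J :: "'a \<Rightarrow> 'a tvec \<Rightarrow> 'a tvec"
    and g :: "'a \<Rightarrow> 'a tvec \<Rightarrow> 'a tvec \<Rightarrow> real"
    and D0 :: "'a vfield \<Rightarrow> 'a vfield \<Rightarrow> 'a vfield"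
    and \<Omega> :: "'a vfield"
    and n :: nat
  assumes "CARD('m) = 2 * n"
    and "almost_norden A J g"
    and "\<not> class_W2_W3 A J g"
    and "levi_civita A g D0"
    and "is_lie_vector A J g D0 \<Omega>"
  shows "\<forall>l1 l2 l3 l4 :: real.
    let Q = difference_tensor (lie_form A J g D0) (endo_app J) \<Omega> l1 l2 l3 l4;
        D = (\<lambda>X Y. D0 X Y + Q X Y)
    in connection A D \<and> completely_symmetric A g D0 D"
proof (intro allI)
  fix l1 l2 l3 l4 :: real
  define V where "V = vector_fields A"
  define \<theta> where "\<theta> = lie_form A J g D0"
  define K where "K = endo_app J"
  define Q where "Q = difference_tensor \<theta> K \<Omega> l1 l2 l3 l4"
  define D where "D = (\<lambda>X Y. D0 X Y + Q X Y)"
  have A: "smooth_atlas A" and J: "almost_complex A J" and g: "pseudo_riemannian A g"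
    using assms(2) by (auto simp: almost_norden_def)
  note add = vector_fields_add[OF A, folded V_def]
    and fscale = vector_fields_fscale[OF A, folded V_def]
  \<comment> \<open>\<open>lie_form\<close> is a definite description; on vector fields
    \<open>is_lie_vector\<close> gives its value, so \<theta> inherits smoothness and linearity from
    the metric.\<close>
  have \<Omega>: "\<Omega> \<in> V" and \<theta>: "\<And>X. X \<in> V \<Longrightarrow> \<theta> X = form_app g X \<Omega>"
    using assms(5) by (auto simp: is_lie_vector_def V_def \<theta>_def)
  have K: "K X \<in> V" if "X \<in> V" for X
    using endo_app_vector_fields[OF J] that by (simp add: V_def K_def)
  have \<theta>_smooth: "\<theta> X \<in> smooth_funs A" if "X \<in> V" for X
    using form_app_smooth[OF g] that \<Omega> by (simp add: \<theta> V_def)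
  have \<theta>_add: "\<theta> (X + Y) = \<theta> X + \<theta> Y" if "X \<in> V" "Y \<in> V" for X Y
    using form_app_add[OF g] that \<Omega> add[OF that] by (simp add: \<theta>) (simp add: V_def)
  have \<theta>_fscale: "\<theta> (f \<odot> X) = f * \<theta> X" if "X \<in> V" "f \<in> smooth_funs A" for X f
    using form_app_fscale[OF g] that \<Omega> fscale[OF that(2,1)] by (simp add: \<theta>) (simp add: V_def)
  have K_add: "K (X + Y) = K X + K Y" if "X \<in> V" "Y \<in> V" for X Y
    using endo_app_add[OF J] that by (simp add: V_def K_def)
  have K_fscale: "K (f \<odot> X) = f \<odot> K X" if "X \<in> V" for X f
    using endo_app_fscale[OF J] that by (simp add: V_def K_def)

  define a where "a X Y = (\<lambda>_. l1) * \<theta> X * \<theta> Y + (\<lambda>_. l3) * (\<theta> X * \<theta> (K Y) + \<theta> (K X) * \<theta> Y)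
    + (\<lambda>_. l4) * \<theta> (K X) * \<theta> (K Y)" for X Y
  define b where "b X Y = (\<lambda>_. l2) * \<theta> (K X) * \<theta> (K Y) + (\<lambda>_. l3) * \<theta> X * \<theta> Y
    + (\<lambda>_. l4) * (\<theta> (K X) * \<theta> Y + \<theta> X * \<theta> (K Y))" for X Y
  have Q: "Q X Y = a X Y \<odot> \<Omega> + b X Y \<odot> K \<Omega>" for X Y
    unfolding Q_def a_def b_def by (rule difference_tensor_eq)
  have ab_smooth: "a X Y \<in> smooth_funs A" "b X Y \<in> smooth_funs A" if "X \<in> V" "Y \<in> V" for X Y
    unfolding a_def b_def using that
    by (auto intro!: smooth_funs_add[OF A] smooth_funs_mult[OF A] smooth_funs_const \<theta>_smooth K)
  have Q_V: "Q X Y \<in> V" if "X \<in> V" "Y \<in> V" for X Y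
    unfolding Q using that by (intro add fscale ab_smooth \<Omega> K)
  \<comment> \<open>Swapping the arguments only exchanges the mixed products. Linearity then has to
    be checked in the first argument alone.\<close>
  have Q_commute: "Q X Y = Q Y X" for X Y
    by (simp add: Q a_def b_def algebra_simps)
  have Q_add: "Q (X + Z) Y = Q X Y + Q Z Y" if "X \<in> V" "Y \<in> V" "Z \<in> V" for X Y Z
    using that by (simp add: Q a_def b_def \<theta>_add K_add K algebra_simps fscale_algebra)
  have Q_fscale: "Q (f \<odot> X) Y = f \<odot> Q X Y" if "X \<in> V" "Y \<in> V" "f \<in> smooth_funs A" for X Y f
    using that by (simp add: Q a_def b_def \<theta>_fscale K_fscale K algebra_simps fscale_algebra)

  have D0: "D0 X Y \<in> V" "f \<in> smooth_funs A \<Longrightarrow> D0 (f \<odot> X) Y = f \<odot> D0 X Y"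
      "f \<in> smooth_funs A \<Longrightarrow> D0 X (f \<odot> Y) = vderiv X f \<odot> Y + f \<odot> D0 X Y"
      "Z \<in> V \<Longrightarrow> D0 (X + Z) Y = D0 X Y + D0 Z Y" "Z \<in> V \<Longrightarrow> D0 X (Y + Z) = D0 X Y + D0 X Z"
    if "X \<in> V" "Y \<in> V" for X Y Z f
    using assms(4) that by (auto simp: levi_civita_def connection_def V_def)
  have "connection A D"
    unfolding connection_def V_def[symmetric]
  proof (intro ballI conjI)
    fix X Y assume XY: "X \<in> V" "Y \<in> V"
    show "D X Y \<in> V" unfolding D_def by (intro add D0 Q_V XY)
    show "D (f \<odot> X) Y = f \<odot> D X Y" if "f \<in> smooth_funs A" for f
      using XY that by (simp add: D_def D0 Q_fscale fscale_algebra)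
    \<comment> \<open>The derivative term comes entirely from \<open>D0\<close>, since
      \<open>Q\<close> is linear over smooth functions in its second argument too.\<close>
    show "D X (f \<odot> Y) = vderiv X f \<odot> Y + f \<odot> D X Y" if "f \<in> smooth_funs A" for f
      using XY that by (simp add: D_def D0 Q_commute[of X] Q_fscale fscale_algebra add.assoc)
    show "D (X + Z) Y = D X Y + D Z Y" if "Z \<in> V" for Z
      using XY that by (simp add: D_def D0 Q_add ac_simps)
    show "D X (Y + Z) = D X Y + D X Z" if "Z \<in> V" for Z
      using XY that by (simp add: D_def D0 Q_commute[of X] Q_add ac_simps)
  qed
  \<comment> \<open>The contributions of \<open>Q\<close> cancel in \<open>D X Y - D Y X\<close>,
    leaving the torsion of \<open>D0\<close>.\<close>
  moreover have "torsion_free A D"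
    using assms(4) Q_commute by (simp add: levi_civita_def torsion_free_def D_def)
  moreover have "form_app g (Q X Y) Z = a X Y * \<theta> Z + b X Y * \<theta> (K Z)"
    if "X \<in> V" "Y \<in> V" "Z \<in> V" for X Y Z
  proof -
    \<comment> \<open>Self-adjointness moves \<open>K\<close> from \<Omega> to \<open>Z\<close>,
      where pairing with \<Omega> is \<theta>.\<close>
    have "form_app g (K \<Omega>) Z = form_app g \<Omega> (K Z)"
      using norden_self_adjoint[OF assms(2)] \<Omega> that(3)
      by (simp add: form_app_def K_def endo_app_def V_def vector_fields_def)
    also have "\<dots> = \<theta> (K Z)"
      using form_app_commute[OF g] \<Omega> K[OF that(3)] by (simp add: \<theta>) (simp add: V_def)
    finally have "form_app g (K \<Omega>) Z = \<theta> (K Z)" .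
    moreover have "form_app g \<Omega> Z = \<theta> Z"
      using form_app_commute[OF g] \<Omega> that(3) by (simp add: \<theta>) (simp add: V_def)
    moreover have "a X Y \<odot> \<Omega> \<in> V" "b X Y \<odot> K \<Omega> \<in> V"
      using that by (auto intro!: fscale ab_smooth \<Omega> K)
    ultimately show ?thesis
      using form_app_add[OF g] form_app_fscale[OF g] \<Omega> K[OF \<Omega>] that(3)
      by (simp add: Q V_def)
  qed
  \<comment> \<open>The parameters \<open>l3\<close> and \<open>l4\<close> occur in both
    \<open>a\<close> and \<open>b\<close> so that the products with \<open>\<theta> Z\<close> and
    \<open>\<theta> (K Z)\<close> combine into full symmetric sums: \<open>l3\<close> weights the
    three terms with one \<open>K\<close>, \<open>l4\<close> the three with two. The terms of
    \<open>l1\<close> and \<open>l2\<close> are cubes, hence invariant under exchanging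
    \<open>Y\<close> and \<open>Z\<close>.\<close>
  then have "form_app g (Q X Y) Z = form_app g (Q X Z) Y" if "X \<in> V" "Y \<in> V" "Z \<in> V" for X Y Z
    using that by (simp add: a_def b_def algebra_simps)
  ultimately have "connection A D \<and> completely_symmetric A g D0 D"
    using Q_commute by (simp add: completely_symmetric_def V_def[symmetric] D_def)
  then show "let Q = difference_tensor (lie_form A J g D0) (endo_app J) \<Omega> l1 l2 l3 l4;
        D = (\<lambda>X Y. D0 X Y + Q X Y)
    in connection A D \<and> completely_symmetric A g D0 D"
    by (simp add: Let_def D_def Q_def \<theta>_def K_def)
qed

end
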